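(* Let $A$ be a countable, torsion-free, nonfree abelian group, let $0\to K\xrightarrow{\subseteq} F\xrightarrow{\pi} A\to 0$ be a short exact sequence with $F$ and $K$ free abelian groups and $K$ a subgroup of $F$, and let $B_K$ be a basis of $K$. Then there is a homomorphism $\varphi:K\to\mathbb{Z}$ such that (1) $\varphi$ does not extend to a homomorphism $\psi:F\to\mathbb{Z}$, and (2) $\varphi[B_K]\subseteq\{0,1\}$. *)

theory Defs
  imports "HOL-Algebra.Algebra" "HOL-Library.Countable_Set"
begin

text \<open>
  Abelian groups are commutative groups in the sense of HOL-Algebra and hence written
  multiplicatively: the element usually written \<open>n \<cdot> x\<close> (for an integer \<open>n\<close>) is the power
  \<open>x [^] n\<close>, and a finite \<open>\<int>\<close>-linear combination is a finite product of such powers.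
\<close>

definition torsion_free_group :: "('a, 'm) monoid_scheme \<Rightarrow> bool" where
  "torsion_free_group G \<longleftrightarrow>
     (\<forall>x\<in>carrier G. \<forall>n::nat. n > 0 \<longrightarrow> x [^]\<^bsub>G\<^esub> n = \<one>\<^bsub>G\<^esub> \<longrightarrow> x = \<one>\<^bsub>G\<^esub>)"

definition int_independent :: "('a, 'm) monoid_scheme \<Rightarrow> 'a set \<Rightarrow> bool" where
  "int_independent G B \<longleftrightarrow>
     (\<forall>T. \<forall>u :: 'a \<Rightarrow> int. finite T \<longrightarrow> T \<subseteq> B \<longrightarrow>
        (\<Otimes>\<^bsub>G\<^esub>b\<in>T. b [^]\<^bsub>G\<^esub> u b) = \<one>\<^bsub>G\<^esub> \<longrightarrow> (\<forall>b\<in>T. u b = 0))"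

definition abelian_group_basis :: "('a, 'm) monoid_scheme \<Rightarrow> 'a set \<Rightarrow> bool" where
  "abelian_group_basis G B \<longleftrightarrow>
     B \<subseteq> carrier G \<and> int_independent G B \<and> generate G B = carrier G"

definition free_abelian :: "('a, 'm) monoid_scheme \<Rightarrow> bool" where
  "free_abelian G \<longleftrightarrow> comm_group G \<and> (\<exists>B. abelian_group_basis G B)"

text \<open>
  The sequence \<open>0 \<rightarrow> K \<rightarrow> F \<rightarrow> A \<rightarrow> 0\<close> whose first map is the inclusion of the subgroup \<open>K\<close> of \<open>F\<close>
  and whose second map is \<open>p\<close>. The library's \<open>short_exact_sequence\<close> puts all groups on
  one type; here \<open>F\<close> and \<open>A\<close> may have different types. The two notions agree on a common type,
  see \<open>exact_inclusion_iff_short_exact_sequence\<close> below.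
\<close>

definition exact_inclusion ::
  "'f set \<Rightarrow> ('f, 'm) monoid_scheme \<Rightarrow> ('f \<Rightarrow> 'a) \<Rightarrow> ('a, 'n) monoid_scheme \<Rightarrow> bool" where
  "exact_inclusion K F p A \<longleftrightarrow>
     subgroup K F \<and> p \<in> hom F A \<and> kernel F A p = K \<and> p ` carrier F = carrier A"

lemma exact_inclusion_iff_short_exact_sequence:
  fixes F A :: "'a monoid"
  assumes "group F" "group A" "subgroup K F"
  shows "exact_inclusion K F p A \<longleftrightarrow>
         short_exact_sequence A F (F\<lparr>carrier := K\<rparr>) p (\<lambda>x. x)"
proof -
  have K: "group (F\<lparr>carrier := K\<rparr>)"
    using assms by (simp add: group.subgroup_imp_group)
  have "K \<subseteq> carrier F"
    using assms(3) by (rule subgroup.subset)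
  then show ?thesis
    using assms K
    by (auto simp: exact_inclusion_def short_exact_sequence_iff epi_def mon_def
        group_hom_def group_hom_axioms_def hom_def)
qed

lemma hom_free_Abelian_group_sum:
  assumes "comm_group G" and h: "h \<in> hom (free_Abelian_group S) G"
    and "finite T" "T \<subseteq> S"
  shows "h (\<Sum>b\<in>T. frag_cmul (u b) (frag_of b)) = (\<Otimes>\<^bsub>G\<^esub>b\<in>T. h (frag_of b) [^]\<^bsub>G\<^esub> u b)"
proof -
  interpret G: comm_group G by fact
  interpret h: group_hom "free_Abelian_group S" G h
    by (simp add: h group_hom_def group_hom_axioms_def)
  have hc: "h (frag_of b) \<in> carrier G" if "b \<in> S" for b
    using that by (simp add: h.hom_closed)
  show ?thesis
    using assms(3,4)
  proof (induction T)
    case empty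
    then show ?case using h.hom_one by simp
  next
    case (insert b T)
    have k: "frag_cmul (u b) (frag_of b) \<in> carrier (free_Abelian_group S)"
      if "b \<in> S" for b
      using that by (simp add: keys_cmul order_trans[OF keys_cmul])
    have k2: "(\<Sum>b\<in>T. frag_cmul (u b) (frag_of b)) \<in> carrier (free_Abelian_group S)"
      by (rule sum_closed_free_Abelian_group) (use insert k in blast)
    have p: "h (frag_cmul (u b) (frag_of b)) = h (frag_of b) [^]\<^bsub>G\<^esub> u b"
      using h.hom_int_pow[of "frag_of b" "u b"] insert.prems by simp
    have "h (frag_cmul (u b) (frag_of b) + (\<Sum>b\<in>T. frag_cmul (u b) (frag_of b)))
        = h (frag_cmul (u b) (frag_of b)) \<otimes>\<^bsub>G\<^esub> h (\<Sum>b\<in>T. frag_cmul (u b) (frag_of b))"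
      using h.hom_mult[OF k k2] insert.prems by simp
    then show ?case
      using insert p hc by (auto simp: subset_iff Pi_def)
  qed
qed

lemma free_abelian_iff_iso_free_Abelian_group:
  fixes G :: "('a, 'm) monoid_scheme"
  assumes "comm_group G"
  shows "free_abelian G \<longleftrightarrow> (\<exists>S :: 'a set. free_Abelian_group S \<cong> G)"
proof
  interpret G: comm_group G by fact
  assume "free_abelian G"
  then obtain B where B: "B \<subseteq> carrier G" "int_independent G B" "generate G B = carrier G"
    by (auto simp: free_abelian_def abelian_group_basis_def)
  obtain h where h: "h \<in> hom (free_Abelian_group B) G" "\<And>x. x \<in> B \<Longrightarrow> h (frag_of x) = x"
    using G.free_Abelian_group_universal[of "\<lambda>x. x" B] B(1) by auto
  interpret h: group_hom "free_Abelian_group B" G h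
    by (simp add: h group_hom_def group_hom_axioms_def)
  have "B \<subseteq> h ` carrier (free_Abelian_group B)"
    using h(2) by (metis frag_of_in_free_Abelian_group image_eqI subsetI)
  then have "carrier G \<subseteq> h ` carrier (free_Abelian_group B)"
    using G.generate_subgroup_incl[OF _ h.img_is_subgroup] B(3) by metis
  moreover have "x = 0" if x: "Poly_Mapping.keys x \<subseteq> B" "h x = \<one>\<^bsub>G\<^esub>" for x
  proof -
    have "h x = (\<Otimes>\<^bsub>G\<^esub>b\<in>Poly_Mapping.keys x. h (frag_of b) [^]\<^bsub>G\<^esub> Poly_Mapping.lookup x b)"
      using hom_free_Abelian_group_sum[OF assms h(1) finite_keys x(1), of "Poly_Mapping.lookup x"]
      by (simp flip: frag_extend_def frag_expansion)
    also have "\<dots> = (\<Otimes>\<^bsub>G\<^esub>b\<in>Poly_Mapping.keys x. b [^]\<^bsub>G\<^esub> Poly_Mapping.lookup x b)"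
      using B(1) x(1) h(2) by (intro G.finprod_cong') (auto simp: subset_iff)
    finally have "\<forall>b\<in>Poly_Mapping.keys x. Poly_Mapping.lookup x b = 0"
      using B(2) x finite_keys unfolding int_independent_def by metis
    then show ?thesis
      by (metis in_keys_iff keys_eq_empty all_not_in_conv)
  qed
  then have "inj_on h (carrier (free_Abelian_group B))"
    by (auto simp: h.inj_on_one_iff)
  ultimately have "h \<in> iso (free_Abelian_group B) G"
    using h(1) by (auto simp: iso_def bij_betw_def hom_def)
  then show "\<exists>S :: 'a set. free_Abelian_group S \<cong> G"
    by (auto simp: is_iso_def)
next
  interpret G: comm_group G by fact
  assume "\<exists>S :: 'a set. free_Abelian_group S \<cong> G"
  then obtain S :: "'a set" and f where f: "f \<in> iso (free_Abelian_group S) G"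
    by (auto simp: is_iso_def)
  then have fh: "f \<in> hom (free_Abelian_group S) G"
    and bij: "bij_betw f (carrier (free_Abelian_group S)) (carrier G)"
    by (auto simp: iso_def)
  interpret f: group_hom "free_Abelian_group S" G f
    by (simp add: fh group_hom_def group_hom_axioms_def)
  define g where "g = (\<lambda>s. f (frag_of s))"
  have gc: "g ` S \<subseteq> carrier G"
    by (auto simp: g_def f.hom_closed)
  have inj: "inj_on g S"
    using bij unfolding g_def bij_betw_def inj_on_def
    by (metis frag_of_eq frag_of_in_free_Abelian_group)
  have "int_independent G (g ` S)"
    unfolding int_independent_def
  proof (intro allI impI ballI)
    fix T and u :: "'a \<Rightarrow> int" and b
    assume T: "finite T" "T \<subseteq> g ` S" "(\<Otimes>\<^bsub>G\<^esub>b\<in>T. b [^]\<^bsub>G\<^esub> u b) = \<one>\<^bsub>G\<^esub>" "b \<in> T"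
    then obtain R where R: "finite R" "R \<subseteq> S" "T = g ` R"
      by (meson finite_subset_image)
    let ?x = "\<Sum>s\<in>R. frag_cmul (u (g s)) (frag_of s)"
    have injR: "inj_on g R"
      using inj R(2) by (rule inj_on_subset)
    have "f ?x = (\<Otimes>\<^bsub>G\<^esub>s\<in>R. g s [^]\<^bsub>G\<^esub> u (g s))"
      using hom_free_Abelian_group_sum[OF assms fh R(1,2)] by (simp add: g_def)
    also have "\<dots> = (\<Otimes>\<^bsub>G\<^esub>b\<in>T. b [^]\<^bsub>G\<^esub> u b)"
      unfolding R(3) using gc R(2) injR by (subst G.finprod_reindex) auto
    finally have "f ?x = \<one>\<^bsub>G\<^esub>"
      using T(3) by simp
    moreover have "?x \<in> carrier (free_Abelian_group S)"
      by (rule sum_closed_free_Abelian_group)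
        (use R(2) in \<open>auto intro: order_trans[OF keys_cmul] dest!: subsetD[OF keys_cmul]\<close>)
    ultimately have x0: "?x = 0"
      using bij f.inj_on_one_iff unfolding bij_betw_def by (metis one_free_Abelian_group)
    obtain s where s: "s \<in> R" "b = g s"
      using T(4) R(3) by auto
    have "Poly_Mapping.lookup ?x s = (\<Sum>r\<in>R. if r = s then u (g r) else 0)"
      unfolding lookup_sum by (rule sum.cong) (auto simp: lookup_frag_of)
    then show "u b = 0"
      using x0 s R(1) by simp
  qed
  moreover have "generate G (g ` S) = carrier G"
  proof
    show "generate G (g ` S) \<subseteq> carrier G"
      using gc by (rule G.generate_incl)
    have sub: "subgroup (generate G (g ` S)) G"
      using gc by (rule G.generate_is_subgroup)
    have "f x \<in> generate G (g ` S)" if "Poly_Mapping.keys x \<subseteq> S" for x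
      using that
    proof (induction x rule: free_Abelian_group_induct[consumes 1])
      case 1
      then show ?case using f.hom_one sub by (simp add: subgroup.one_closed)
    next
      case (2 x y)
      then have "f (x - y) = f x \<otimes>\<^bsub>G\<^esub> inv\<^bsub>G\<^esub> f y"
        using f.hom_mult[of x "- y"] f.hom_inv[of y] by simp
      then show ?case
        using 2 sub by (simp add: subgroup.m_closed subgroup.m_inv_closed)
    next
      case (3 a)
      then show ?case by (auto simp: g_def intro: generate.incl)
    qed
    then show "carrier G \<subseteq> generate G (g ` S)"
      using bij unfolding bij_betw_def by (metis carrier_free_Abelian_group_iff imageE subsetI)
  qed
  ultimately show "free_abelian G"
    using assms gc by (auto simp: free_abelian_def abelian_group_basis_def)
qed

end

theory Submission
  imports Defs
begin

text \<open>
  By Pontryagin's criterion, the countable torsion-free nonfree group \<open>A\<close> has a finite subset \<open>S\<close>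
  whose pure closure is not finitely generated. Lift \<open>S\<close> to a finite set \<open>E\<close> in \<open>F\<close>. Every lift \<open>f\<close> of an
  element of the pure closure of \<open>S\<close> satisfies \<open>f\<^sup>m \<in> K \<cdot> \<langle>E\<rangle>\<close> for some \<open>m > 0\<close>, so an extension \<open>\<psi>\<close> of \<open>\<phi>\<close>
  is determined at \<open>f\<close> by \<open>\<phi>\<close> and the restriction of \<open>\<psi>\<close> to \<open>E\<close>, for which there are only countably many
  candidates. They are excluded one after the other, each by fixing finitely many values of \<open>\<phi>\<close> on the
  basis of \<open>K\<close>. If \<open>\<phi>\<close> is already fixed on a finite set \<open>D\<close>, the pure closure of \<open>E \<union> D\<close> in the free group
  \<open>F\<close> is finitely generated, so its image misses some \<open>x\<close> in the pure closure of \<open>S\<close>. For a lift \<open>f\<close> of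
  \<open>x\<close>, the \<open>K\<close>-part of \<open>f\<^sup>m\<close> has, at some basis element outside \<open>D\<close>, a coefficient not divisible by \<open>m\<close>;
  hence at least one of the values 0 and 1 there makes the value required at \<open>f\<^sup>m\<close> indivisible by \<open>m\<close>.
\<close>

section \<open>Finite products of powers, and homomorphisms to the integers\<close>

lemma (in group) generate_finite_support:
  assumes "x \<in> generate G B"
  shows "\<exists>T. finite T \<and> T \<subseteq> B \<and> x \<in> generate G T"
  using assms
proof (induction rule: generate.induct)
  case one
  then show ?case by (intro exI[of _ "{}"]) (simp add: generate.one)
next
  case (incl h)
  then show ?case by (intro exI[of _ "{h}"]) (simp add: generate.incl)
next
  case (inv h)
  then show ?case by (intro exI[of _ "{h}"]) (simp add: generate.inv)
next
  case (eng x y)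
  then obtain S T where "finite S" "S \<subseteq> B" "x \<in> generate G S"
    "finite T" "T \<subseteq> B" "y \<in> generate G T" by blast
  then show ?case
    using mono_generate[of S "S \<union> T"] mono_generate[of T "S \<union> T"]
    by (intro exI[of _ "S \<union> T"]) (auto intro: generate.eng)
qed

lemma (in comm_group) generate_finite_rep:
  assumes T: "finite T" "T \<subseteq> carrier G" and "x \<in> generate G T"
  shows "\<exists>u :: 'a \<Rightarrow> int. x = (\<Otimes>b\<in>T. b [^] u b)"
proof -
  have delta: "(\<Otimes>b\<in>T. b [^] (if b = h then n else 0)) = h [^] n" if "h \<in> T" for h and n :: int
  proof -
    have "(\<Otimes>b\<in>T. b [^] (if b = h then n else 0)) = (\<Otimes>b\<in>T. if b = h then b [^] n else \<one>)"
      using T by (intro finprod_cong') auto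
    also have "\<dots> = h [^] n"
      using T that by (intro finprod_singleton_swap) auto
    finally show ?thesis .
  qed
  show ?thesis
    using assms(3)
  proof (induction rule: generate.induct)
    case one
    then show ?case by (intro exI[of _ "\<lambda>_. 0"]) simp
  next
    case (incl h)
    then have "h = (\<Otimes>b\<in>T. b [^] (if b = h then 1 else 0 :: int))"
      using delta[of h 1] T by auto
    then show ?case by (intro exI[of _ "\<lambda>b. if b = h then 1 else 0"])
  next
    case (inv h)
    then have "inv h = (\<Otimes>b\<in>T. b [^] (if b = h then - 1 else 0 :: int))"
      using delta[of h "- 1"] T by (auto simp: int_pow_neg)
    then show ?case by (intro exI[of _ "\<lambda>b. if b = h then - 1 else 0"])
  next
    case (eng x y)
    then obtain u v where "x = (\<Otimes>b\<in>T. b [^] (u b :: int))" "y = (\<Otimes>b\<in>T. b [^] (v b :: int))"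
      by blast
    moreover have "(\<Otimes>b\<in>T. b [^] (u b + v b)) = (\<Otimes>b\<in>T. b [^] u b \<otimes> b [^] v b)"
      using T by (intro finprod_cong') (auto simp: int_pow_mult)
    moreover have "\<dots> = (\<Otimes>b\<in>T. b [^] u b) \<otimes> (\<Otimes>b\<in>T. b [^] v b)"
      using T by (intro finprod_multf) auto
    ultimately show ?case by (intro exI[of _ "\<lambda>b. u b + v b"]) simp
  qed
qed

lemma (in comm_group) hom_integer_group_finprod:
  fixes u :: "'a \<Rightarrow> int"
  assumes h: "h \<in> hom G integer_group" and "T \<subseteq> carrier G"
  shows "h (\<Otimes>b\<in>T. b [^] u b) = (\<Sum>b\<in>T. u b * h b)"
proof -
  interpret h: group_hom G integer_group h
    using h by (simp add: group_hom_def group_hom_axioms_def)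
  show ?thesis
    using assms(2)
  proof (induction T rule: infinite_finite_induct)
    case (insert b T)
    then have "(\<Otimes>b\<in>T. b [^] u b) \<in> carrier G"
      by (intro finprod_closed) auto
    then show ?case
      using insert h.hom_int_pow[of b "u b"] h.hom_mult[of "b [^] u b"] by (auto simp: Pi_def subset_iff)
  \<comment> \<open>For infinite \<open>T\<close> both sides take their default values,
    \<open>\<one>\<close> and 0, so this case comes down to \<open>h.hom_one\<close> just as the
    empty one does.\<close>
  qed (use h.hom_one in simp_all)
qed

lemma (in comm_group) subgroup_finprod_closed:
  assumes "subgroup H G" "\<And>b. b \<in> T \<Longrightarrow> f b \<in> H"
  shows "(\<Otimes>b\<in>T. f b) \<in> H"
proof -
  interpret H: subgroup H G by fact
  show ?thesis
    using assms(2)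
  proof (induction T rule: infinite_finite_induct)
    case (insert b T)
    have "f \<in> T \<rightarrow> carrier G" "f b \<in> carrier G"
      using insert.prems H.subset by auto
    then show ?case
      using insert by simp
  qed simp_all
qed

text \<open>The inclusion of \<open>B\<close> induces an isomorphism \<open>f\<close> from
  \<open>free_Abelian_group B\<close>: onto because \<open>B\<close> generates, injective by
  independence. The map \<open>e\<close> that the universal property gives for \<open>g\<close> is
  carried over along the inverse of \<open>f\<close>.\<close>

lemma (in comm_group) hom_extends_basis:
  fixes g :: "'a \<Rightarrow> int"
  assumes "abelian_group_basis G B"
  shows "\<exists>h \<in> hom G integer_group. \<forall>b\<in>B. h b = g b"
proof -
  have B: "B \<subseteq> carrier G" "int_independent G B" "generate G B = carrier G"
    using assms by (auto simp: abelian_group_basis_def)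
  obtain f where f: "f \<in> hom (free_Abelian_group B) G" "\<And>x. x \<in> B \<Longrightarrow> f (frag_of x) = x"
    using free_Abelian_group_universal[of "\<lambda>x. x" B] B(1) by auto
  interpret Z: comm_group integer_group by (rule abelian_integer_group)
  obtain e where e: "e \<in> hom (free_Abelian_group B) integer_group" "\<And>x. x \<in> B \<Longrightarrow> e (frag_of x) = g x"
    using Z.free_Abelian_group_universal[of g B] by auto
  interpret f: group_hom "free_Abelian_group B" G f
    using f(1) by (simp add: group_hom_def group_hom_axioms_def)
  have "B \<subseteq> f ` carrier (free_Abelian_group B)"
    using f(2) by (metis frag_of_in_free_Abelian_group image_eqI subsetI)
  then have surj: "f ` carrier (free_Abelian_group B) = carrier G"
    using generate_subgroup_incl[OF _ f.img_is_subgroup] B(3) f.hom_closed by blast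
  have "x = 0" if x: "Poly_Mapping.keys x \<subseteq> B" "f x = \<one>" for x
  proof -
    have "f x = (\<Otimes>b\<in>Poly_Mapping.keys x. f (frag_of b) [^] Poly_Mapping.lookup x b)"
      using hom_free_Abelian_group_sum[OF comm_group_axioms f(1) finite_keys x(1), of "Poly_Mapping.lookup x"]
      by (simp flip: frag_extend_def frag_expansion)
    also have "\<dots> = (\<Otimes>b\<in>Poly_Mapping.keys x. b [^] Poly_Mapping.lookup x b)"
      using B(1) x(1) f(2) by (intro finprod_cong') (auto simp: subset_iff)
    finally have "\<forall>b\<in>Poly_Mapping.keys x. Poly_Mapping.lookup x b = 0"
      using B(2) x finite_keys unfolding int_independent_def by metis
    then show ?thesis
      by (metis in_keys_iff keys_eq_empty all_not_in_conv)
  qed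
  then have inj: "inj_on f (carrier (free_Abelian_group B))"
    by (auto simp: f.inj_on_one_iff)
  with surj f(1) have iso: "f \<in> iso (free_Abelian_group B) G"
    by (auto simp: iso_def bij_betw_def)
  let ?k = "inv_into (carrier (free_Abelian_group B)) f"
  have k: "?k \<in> hom G (free_Abelian_group B)"
    using group.iso_set_sym[OF _ iso] by (auto simp: iso_def)
  have "(e \<circ> ?k) b = g b" if "b \<in> B" for b
  proof -
    have "?k b = frag_of b"
      using inv_into_f_f[OF inj, of "frag_of b"] f(2)[OF that] that by simp
    then show ?thesis using e(2) that by simp
  qed
  moreover have "e \<circ> ?k \<in> hom G integer_group"
    using k e(1) by (auto simp: hom_def)
  ultimately show ?thesis by blast
qed

section \<open>Subgroups of finitely generated abelian groups\<close>

text \<open>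
  \<open>R\<close> is a subgroup of \<open>G \<times> \<int>\<close>, and \<open>d\<close> generates its projection to \<open>\<int>\<close>. A relation instead of a
  function accommodates that the exponent \<open>c\<close> need not be determined by \<open>x\<close>.
\<close>

lemma (in comm_group) additive_relation_generator:
  fixes R :: "'a \<Rightarrow> int \<Rightarrow> bool"
  assumes carr: "\<And>x c. R x c \<Longrightarrow> x \<in> carrier G"
    and one: "R \<one> 0"
    and diff: "\<And>x y c d. R x c \<Longrightarrow> R y d \<Longrightarrow> R (x \<otimes> inv y) (c - d)"
  shows "\<exists>b d. R b d \<and> (\<forall>x c. R x c \<longrightarrow> (\<exists>k :: int. R (x \<otimes> inv (b [^] k)) 0))"
proof (cases "\<exists>x c. R x c \<and> c > 0")
  \<comment> \<open>No exponent is positive, hence none is negative either, by subtracting from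
    \<open>R \<one> 0\<close>; then \<open>b = \<one>\<close> and \<open>d = 0\<close> will
    do.\<close>
  case False
  have "c = 0" if "R x c" for x c
  proof -
    have "\<not> c > 0" using False that by blast
    moreover have "\<not> - c > 0" using diff[OF one that] False by force
    ultimately show ?thesis by simp
  qed
  moreover have "x \<otimes> inv (\<one> [^] (0 :: int)) = x" if "R x c" for x c
    using carr[OF that] by simp
  ultimately show ?thesis using one by metis
next
  case True
  \<comment> \<open>As for subgroups of the integers: the least positive exponent \<open>d\<close>
    divides every exponent, since the remainder of \<open>c\<close> modulo \<open>d\<close> is again
    an exponent that occurs.\<close>
  define P where "P n \<longleftrightarrow> n > 0 \<and> (\<exists>x. R x (int n))" for n
  define d where "d = (LEAST n. P n)"
  from True obtain x c where "R x c" "c > 0" by blast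
  then have "P (nat c)" by (auto simp: P_def)
  then have "P d" unfolding d_def by (rule LeastI)
  then obtain b where b: "R b (int d)" and d: "d > 0" by (auto simp: P_def)
  have bc: "b \<in> carrier G" using carr[OF b] .
  have min: "c \<le> 0" if "R x c" "c < int d" for x c
  proof (rule ccontr)
    assume "\<not> c \<le> 0"
    then have "P (nat c)" using that by (auto simp: P_def)
    then have "d \<le> nat c" unfolding d_def by (rule Least_le)
    then show False using that \<open>\<not> c \<le> 0\<close> by linarith
  qed
  have inv: "R (inv y) (- c)" if "R y c" for y c
    using diff[OF one that] carr[OF that] by simp
  have mult: "R (x \<otimes> y) (c + c')" if "R x c" "R y c'" for x y c c'
    using diff[OF that(1) inv[OF that(2)]] carr[OF that(2)] by simp
  have npow: "R (b [^] n) (int n * int d)" for n :: nat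
  proof (induction n)
    case (Suc n)
    then show ?case using mult[OF Suc b] by (simp add: distrib_right add.commute)
  qed (use one in simp)
  have pow: "R (b [^] k) (k * int d)" for k :: int
  proof (cases "k \<ge> 0")
    case True
    then show ?thesis
      using npow[of "nat k"] int_pow_int[of G b "nat k"] by (metis int_nat_eq)
  next
    case False
    then have "k = - int (nat (- k))" by simp
    then show ?thesis
      using inv[OF npow[of "nat (- k)"]] int_pow_neg_int[OF bc, of "nat (- k)"]
      by (metis mult_minus_left)
  qed
  have "R (x \<otimes> inv (b [^] (c div int d))) 0" if "R x c" for x c
  proof -
    have r: "R (x \<otimes> inv (b [^] (c div int d))) (c mod int d)"
      using diff[OF that pow[of "c div int d"]] by (simp add: minus_div_mult_eq_mod)
    have "c mod int d < int d" "c mod int d \<ge> 0" using d by auto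
    then have "c mod int d = 0" using min[OF r] by linarith
    then show ?thesis using r by simp
  qed
  with b show ?thesis by blast
qed

text \<open>Induction on the generators. Modulo \<open>generate G S\<close> every element of
  \<open>H\<close> is a power of \<open>a\<close>, so one \<open>b\<close> in \<open>H\<close>
  generates \<open>H\<close> modulo its intersection with \<open>generate G S\<close>; the induction
  hypothesis supplies generators of that intersection.\<close>

lemma (in comm_group) subgroup_of_fg:
  assumes "finite S" "S \<subseteq> carrier G" "subgroup H G" "H \<subseteq> generate G S"
  shows "\<exists>Y. finite Y \<and> Y \<subseteq> H \<and> H = generate G Y"
  using assms
proof (induction S arbitrary: H rule: finite_induct)
  case empty
  then have "H = {\<one>}"
    using generate_empty subgroup.one_closed[of H G] by auto
  then show ?case using generate_empty by (intro exI[of _ "{}"]) auto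
next
  case (insert a S)
  interpret H: subgroup H G by fact
  have a: "a \<in> carrier G" and S: "S \<subseteq> carrier G" using insert.prems by auto
  interpret S: subgroup "generate G S" G using generate_is_subgroup[OF S] .
  \<comment> \<open>The exponent \<open>c\<close> records \<open>x\<close> modulo
    \<open>generate G S\<close>; exponent 0 singles out the intersection to which the induction
    hypothesis applies.\<close>
  define R where "R x c \<longleftrightarrow> x \<in> H \<and> x \<otimes> inv (a [^] c) \<in> generate G S" for x and c :: int
  have dist: "x \<otimes> inv y \<otimes> inv (a [^] (c - d)) = (x \<otimes> inv (a [^] c)) \<otimes> inv (y \<otimes> inv (a [^] d))"
    if "x \<in> carrier G" "y \<in> carrier G" for x y and c d :: int
    using that a by (simp add: int_pow_diff inv_mult m_ac)
  have "\<exists>b d. R b d \<and> (\<forall>x c. R x c \<longrightarrow> (\<exists>k :: int. R (x \<otimes> inv (b [^] k)) 0))"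
  proof (rule additive_relation_generator)
    show "R (x \<otimes> inv y) (c - d)" if "R x c" "R y d" for x y c d
      using that unfolding R_def by (subst dist) auto
  qed (auto simp: R_def)
  then obtain b d where b: "R b d" and gen: "\<And>x c. R x c \<Longrightarrow> \<exists>k :: int. R (x \<otimes> inv (b [^] k)) 0"
    by blast
  have bH: "b \<in> H" using b by (simp add: R_def)
  have R0: "R x 0 \<longleftrightarrow> x \<in> H \<inter> generate G S" for x
    by (auto simp: R_def)
  have "\<exists>Y. finite Y \<and> Y \<subseteq> H \<inter> generate G S \<and> H \<inter> generate G S = generate G Y"
    using S by (intro insert.IH subgroups_Inter_pair H.subgroup_axioms S.subgroup_axioms) auto
  then obtain Y where Y: "finite Y" "Y \<subseteq> H" "H \<inter> generate G S = generate G Y" by blast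
  have ex: "\<exists>c :: int. x \<otimes> inv (a [^] c) \<in> generate G S" if x: "x \<in> generate G (insert a S)" for x
  proof -
    obtain u :: "'a \<Rightarrow> int" where "x = (\<Otimes>b\<in>insert a S. b [^] u b)"
      using generate_finite_rep[OF _ _ x] insert.hyps(1) a S by blast
    also have "\<dots> = a [^] u a \<otimes> (\<Otimes>b\<in>S. b [^] u b)"
      using a S insert.hyps by (intro finprod_insert) auto
    finally have eq: "x = a [^] u a \<otimes> (\<Otimes>b\<in>S. b [^] u b)" .
    have m: "(\<Otimes>b\<in>S. b [^] u b) \<in> generate G S"
      by (rule subgroup_finprod_closed[OF S.subgroup_axioms])
        (auto intro: subgroup_int_pow_closed S.subgroup_axioms generate.incl)
    then have "x \<otimes> inv (a [^] u a) = (\<Otimes>b\<in>S. b [^] u b)"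
      using a S.subset by (simp add: eq m_comm[of "a [^] u a"] m_assoc subsetD[OF S.subset])
    with m show ?thesis by (intro exI[of _ "u a"]) simp
  qed
  have "x \<in> generate G (insert b Y)" if x: "x \<in> H" for x
  proof -
    obtain c where "R x c" using ex[of x] x insert.prems(3) unfolding R_def by blast
    then obtain k :: int where "R (x \<otimes> inv (b [^] k)) 0" using gen by blast
    then have y: "x \<otimes> inv (b [^] k) \<in> generate G (insert b Y)"
      using R0 Y(3) mono_generate[of Y "insert b Y"] by auto
    have "subgroup (generate G (insert b Y)) G"
      using bH Y(2) H.subset by (intro generate_is_subgroup) auto
    then have "b [^] k \<in> generate G (insert b Y)"
      by (intro subgroup_int_pow_closed generate.incl) auto
    with y have "(x \<otimes> inv (b [^] k)) \<otimes> b [^] k \<in> generate G (insert b Y)"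
      by (rule generate.eng)
    then show ?thesis using x bH by (simp add: m_assoc)
  qed
  moreover have "generate G (insert b Y) \<subseteq> H"
    using bH Y(2) by (intro generate_subgroup_incl H.subgroup_axioms) auto
  ultimately show ?case using Y bH by (intro exI[of _ "insert b Y"]) auto
qed

section \<open>Pure closures and Pontryagin's criterion\<close>

text \<open>For abelian \<open>G\<close> and \<open>S\<close> inside its carrier, this is the
  preimage of the torsion subgroup of the quotient by \<open>generate G S\<close>; when
  \<open>G\<close> is moreover torsion-free, it is the least pure subgroup containing
  \<open>S\<close>.\<close>

definition pure_closure :: "('a, 'm) monoid_scheme \<Rightarrow> 'a set \<Rightarrow> 'a set" where
  "pure_closure G S = {x \<in> carrier G. \<exists>n :: nat. n > 0 \<and> x [^]\<^bsub>G\<^esub> n \<in> generate G S}"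

lemma pure_closure_carrier: "pure_closure G S \<subseteq> carrier G"
  by (auto simp: pure_closure_def)

lemma (in group) generate_le_pure_closure:
  "S \<subseteq> carrier G \<Longrightarrow> generate G S \<subseteq> pure_closure G S"
  using generate_in_carrier by (fastforce simp: pure_closure_def intro!: exI[of _ "1 :: nat"])

lemma (in group) subgroup_pow_closed:
  "subgroup H G \<Longrightarrow> x \<in> H \<Longrightarrow> x [^] (n :: nat) \<in> H"
  using subgroup_int_pow_closed[of H x "int n"] by (simp add: int_pow_int)

lemma (in comm_group) subgroup_pure_closure:
  assumes "S \<subseteq> carrier G"
  shows "subgroup (pure_closure G S) G"
proof -
  interpret S: subgroup "generate G S" G using generate_is_subgroup[OF assms] .
  show ?thesis
  proof
    fix x y assume "x \<in> pure_closure G S" "y \<in> pure_closure G S"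
    then obtain m n :: nat where *: "x \<in> carrier G" "m > 0" "x [^] m \<in> generate G S"
      "y \<in> carrier G" "n > 0" "y [^] n \<in> generate G S"
      by (auto simp: pure_closure_def)
    have "(x \<otimes> y) [^] (m * n) = (x [^] m) [^] n \<otimes> (y [^] n) [^] m"
      using * by (simp add: nat_pow_distrib nat_pow_pow mult.commute)
    also have "\<dots> \<in> generate G S"
      using * by (meson S.m_closed subgroup_pow_closed S.subgroup_axioms)
    finally show "x \<otimes> y \<in> pure_closure G S"
      using * by (auto simp: pure_closure_def intro!: exI[of _ "m * n"])
  next
    fix x assume "x \<in> pure_closure G S"
    then show "inv x \<in> pure_closure G S"
      by (auto simp: pure_closure_def nat_pow_inv)
  qed (use pure_closure_carrier in \<open>auto simp: pure_closure_def intro!: exI[of _ "1 :: nat"]\<close>)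
qed

lemma (in group) pure_closure_pow:
  assumes "x \<in> carrier G" "n > 0" "x [^] (n :: nat) \<in> pure_closure G S"
  shows "x \<in> pure_closure G S"
proof -
  obtain m :: nat where "m > 0" "(x [^] n) [^] m \<in> generate G S"
    using assms(3) by (auto simp: pure_closure_def)
  then show ?thesis
    using assms by (auto simp: pure_closure_def nat_pow_pow intro!: exI[of _ "n * m"])
qed

lemma (in comm_group) pure_closure_int_pow:
  assumes "x \<in> carrier G" "k \<noteq> 0" "x [^] (k :: int) \<in> pure_closure G S" "S \<subseteq> carrier G"
  shows "x \<in> pure_closure G S"
proof -
  have "x [^] \<bar>k\<bar> \<in> pure_closure G S"
    using assms subgroup.m_inv_closed[OF subgroup_pure_closure[OF assms(4)] assms(3)]
    by (cases "k \<ge> 0") (auto simp: int_pow_neg)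
  then have "x [^] nat \<bar>k\<bar> \<in> pure_closure G S"
    by (metis int_pow_int nat_0_le abs_ge_zero)
  then show ?thesis using assms pure_closure_pow[of x "nat \<bar>k\<bar>"] by simp
qed

lemma (in group) pure_closure_mono: "S \<subseteq> T \<Longrightarrow> pure_closure G S \<subseteq> pure_closure G T"
  using mono_generate[of S T] by (auto simp: pure_closure_def)

text \<open>Finitely many basis elements \<open>C\<close> suffice to express \<open>S\<close>. If a
  positive power of \<open>x\<close> lies in \<open>generate G C\<close>, the coordinates of
  \<open>x\<close> outside \<open>C\<close> vanish, because the integers are torsion-free. So the
  pure closure lies in \<open>generate G C\<close>, and \<open>subgroup_of_fg\<close>
  applies.\<close>

lemma (in comm_group) pure_closure_fg_of_free:
  assumes "free_abelian G" "finite S" "S \<subseteq> carrier G"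
  shows "\<exists>Y. finite Y \<and> Y \<subseteq> carrier G \<and> pure_closure G S = generate G Y"
proof -
  obtain B where B: "abelian_group_basis G B"
    using assms(1) by (auto simp: free_abelian_def)
  then have Bc: "B \<subseteq> carrier G" and gen: "generate G B = carrier G"
    by (auto simp: abelian_group_basis_def)
  have "\<forall>s\<in>S. \<exists>T. finite T \<and> T \<subseteq> B \<and> s \<in> generate G T"
    using generate_finite_support gen assms(3) by blast
  then obtain T where T: "\<And>s. s \<in> S \<Longrightarrow> finite (T s) \<and> T s \<subseteq> B \<and> s \<in> generate G (T s)"
    by metis
  define C where "C = (\<Union>s\<in>S. T s)"
  have C: "finite C" "C \<subseteq> B" using T assms(2) by (auto simp: C_def)
  then have Cc: "C \<subseteq> carrier G" using Bc by blast
  interpret C: subgroup "generate G C" G using generate_is_subgroup[OF Cc] .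
  have "S \<subseteq> generate G C"
  proof
    fix s assume s: "s \<in> S"
    have "T s \<subseteq> C" using s by (auto simp: C_def)
    from mono_generate[OF this] show "s \<in> generate G C" using T[OF s] by blast
  qed
  then have SC: "generate G S \<subseteq> generate G C"
    by (intro generate_subgroup_incl C.subgroup_axioms)
  have "x \<in> generate G C" if "x \<in> pure_closure G S" for x
  proof -
    obtain n :: nat where x: "x \<in> carrier G" and n: "n > 0" and "x [^] n \<in> generate G S"
      using \<open>x \<in> pure_closure G S\<close> by (auto simp: pure_closure_def)
    then have xn: "x [^] n \<in> generate G C" using SC by blast
    obtain U where U: "finite U" "U \<subseteq> B" "x \<in> generate G U"
      using generate_finite_support[of x B] x gen by auto
    obtain u :: "'a \<Rightarrow> int" where u: "x = (\<Otimes>b\<in>U. b [^] u b)"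
      using generate_finite_rep[OF U(1) _ U(3)] U(2) Bc by blast
    have "u b = 0" if b: "b \<in> U" "b \<notin> C" for b
    proof -
      \<comment> \<open>\<open>h\<close> is the coordinate function of \<open>b\<close>: it vanishes
        on \<open>C\<close>, hence at \<open>x [^] n\<close> and at \<open>x\<close>, and its value
        at \<open>x\<close> is \<open>u b\<close>.\<close>
      obtain h where h: "h \<in> hom G integer_group" "\<And>c. c \<in> B \<Longrightarrow> h c = (if c = b then 1 else 0)"
        using hom_extends_basis[OF B, of "\<lambda>c. if c = b then 1 else 0"] by auto
      interpret h: group_hom G integer_group h
        using h(1) by (simp add: group_hom_def group_hom_axioms_def)
      obtain v :: "'a \<Rightarrow> int" where v: "x [^] n = (\<Otimes>b\<in>C. b [^] v b)"
        using generate_finite_rep[OF C(1) Cc xn] by blast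
      have "h (x [^] n) = (\<Sum>c\<in>C. v c * h c)"
        unfolding v using h(1) Cc by (rule hom_integer_group_finprod)
      also have "\<dots> = 0"
        using h(2) C(2) b(2) by (intro sum.neutral) (metis mult_zero_right subsetD)
      finally have "h x = 0"
        using h.hom_nat_pow[OF x, of n] n by simp
      have "U \<subseteq> carrier G" using U(2) Bc by blast
      then have "h x = (\<Sum>c\<in>U. u c * h c)"
        unfolding u using h(1) by (intro hom_integer_group_finprod)
      also have "\<dots> = (\<Sum>c\<in>U. if c = b then u c else 0)"
        using h(2) U(2) by (intro sum.cong) auto
      also have "\<dots> = u b" using U(1) b(1) by simp
      finally show "u b = 0" using \<open>h x = 0\<close> by simp
    qed
    then have "b [^] u b \<in> generate G C" if "b \<in> U" for b
      using that C.one_closed by (cases "b \<in> C") (auto intro: subgroup_int_pow_closed C.subgroup_axioms generate.incl)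
    then show ?thesis
      unfolding u by (rule subgroup_finprod_closed[OF C.subgroup_axioms])
  qed
  then obtain Y where "finite Y" "Y \<subseteq> pure_closure G S" "pure_closure G S = generate G Y"
    using subgroup_of_fg[OF C(1) Cc subgroup_pure_closure[OF assms(3)]] by blast
  then show ?thesis using pure_closure_carrier[of G S] by blast
qed

text \<open>The quotient of the larger pure closure by the smaller one is finitely generated,
  torsion-free and of rank one, hence infinite cyclic; \<open>b\<close> represents a generator of
  it.\<close>

lemma (in comm_group) pure_closure_insert:
  assumes S: "S \<subseteq> carrier G" and a: "a \<in> carrier G" "a \<notin> pure_closure G S"
    and Y: "finite Y" "Y \<subseteq> carrier G" "pure_closure G (insert a S) = generate G Y"
  shows "\<exists>b \<in> pure_closure G (insert a S).
    (\<forall>k :: int. b [^] k \<in> pure_closure G S \<longrightarrow> k = 0) \<and>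
    (\<forall>x \<in> pure_closure G (insert a S). \<exists>k :: int. x \<otimes> inv (b [^] k) \<in> pure_closure G S)"
proof -
  let ?P = "pure_closure G S" and ?Q = "pure_closure G (insert a S)"
  have aS: "insert a S \<subseteq> carrier G" using S a by simp
  interpret P: subgroup ?P G using subgroup_pure_closure[OF S] .
  interpret Q: subgroup ?Q G using subgroup_pure_closure[OF aS] .
  interpret I: subgroup "generate G (insert a S)" G using generate_is_subgroup[OF aS] .
  \<comment> \<open>Multiplying the exponents that work for single elements gives one that works for
    all of \<open>Z\<close>; applied to the generators \<open>Y\<close> it yields one
    \<open>M\<close> for the whole of \<open>?Q\<close>.\<close>
  have exponent: "\<exists>M :: nat. M > 0 \<and> (\<forall>y\<in>Z. y [^] M \<in> generate G (insert a S))"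
    if "finite Z" "Z \<subseteq> ?Q" for Z
    using that
  proof (induction Z rule: finite_induct)
    case empty
    then show ?case by (intro exI[of _ 1]) simp
  next
    case (insert z Z)
    then obtain M where M: "M > 0" "\<And>y. y \<in> Z \<Longrightarrow> y [^] (M :: nat) \<in> generate G (insert a S)" by auto
    obtain n :: nat where n: "n > 0" "z [^] n \<in> generate G (insert a S)" "z \<in> carrier G"
      using insert.prems unfolding pure_closure_def by blast
    have "z [^] (M * n) \<in> generate G (insert a S)"
      using subgroup_pow_closed[OF I.subgroup_axioms n(2), of M] n(3)
      by (simp add: nat_pow_pow mult.commute)
    moreover have "y [^] (M * n) \<in> generate G (insert a S)" if "y \<in> Z" for y
      using subgroup_pow_closed[OF I.subgroup_axioms M(2)[OF that], of n] insert.prems that Q.subset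
      by (simp add: nat_pow_pow subset_iff)
    ultimately show ?case using M(1) n(1) by (intro exI[of _ "M * n"]) auto
  qed
  have "Y \<subseteq> ?Q" unfolding Y(3) using generate.incl by (rule subsetI)
  then obtain M :: nat where M: "M > 0" "\<And>y. y \<in> Y \<Longrightarrow> y [^] M \<in> generate G (insert a S)"
    using exponent[OF Y(1)] by blast
  have MQ: "x [^] M \<in> generate G (insert a S)" if "x \<in> ?Q" for x
    using that unfolding Y(3)
  proof (induction rule: generate.induct)
    case (inv h)
    then show ?case using M(2) Y(2) by (auto simp: nat_pow_inv)
  next
    case (eng x y)
    then have "x \<in> carrier G" "y \<in> carrier G" using generate_in_carrier[OF Y(2)] by auto
    then show ?case using eng by (simp add: nat_pow_distrib)
  qed (use M in auto)
  have ex: "\<exists>c :: int. x \<otimes> inv (a [^] c) \<in> ?P" if "x \<in> generate G (insert a S)" for x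
    using that
  proof (induction rule: generate.induct)
    case one
    show ?case by (intro exI[of _ 0]) simp
  next
    case (incl h)
    show ?case
    proof (cases "h = a")
      case True
      then show ?thesis using a by (intro exI[of _ 1]) simp
    next
      case False
      then have "h \<in> ?P" using incl generate_le_pure_closure[OF S] by (auto intro: generate.incl)
      then show ?thesis by (intro exI[of _ 0]) simp
    qed
  next
    case (inv h)
    show ?case
    proof (cases "h = a")
      case True
      then show ?thesis using a by (intro exI[of _ "- 1"]) (simp add: int_pow_neg)
    next
      case False
      then have "inv h \<in> ?P" using inv generate_le_pure_closure[OF S] by (auto intro: generate.inv)
      then show ?thesis by (intro exI[of _ 0]) simp
    qed
  next
    case (eng x y)
    then obtain c d :: int where *: "x \<otimes> inv (a [^] c) \<in> ?P" "y \<otimes> inv (a [^] d) \<in> ?P" by blast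
    have xy: "x \<in> carrier G" "y \<in> carrier G" using eng generate_in_carrier[OF aS] by auto
    have "x \<otimes> y \<otimes> inv (a [^] (c + d)) = (x \<otimes> inv (a [^] c)) \<otimes> (y \<otimes> inv (a [^] d))"
      using xy a by (simp add: int_pow_mult inv_mult m_ac)
    also have "\<dots> \<in> ?P" using * by (rule P.m_closed)
    finally show ?case by blast
  qed
  \<comment> \<open>Modulo \<open>?P\<close>, the element \<open>x [^] M\<close> is a power of
    \<open>a\<close>, and its exponent \<open>c\<close> is the integer attached to \<open>x\<close>.
    Exponent 0 means \<open>x [^] M \<in> ?P\<close> and so \<open>x \<in> ?P\<close>, as
    \<open>?P\<close> is closed under roots.\<close>
  define R where "R x c \<longleftrightarrow> x \<in> ?Q \<and> x [^] M \<otimes> inv (a [^] c) \<in> ?P" for x and c :: int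
  have dist: "(x \<otimes> inv y) [^] M \<otimes> inv (a [^] (c - d))
      = (x [^] M \<otimes> inv (a [^] c)) \<otimes> inv (y [^] M \<otimes> inv (a [^] d))"
    if "x \<in> carrier G" "y \<in> carrier G" for x y and c d :: int
    using that a by (simp add: int_pow_diff inv_mult m_ac nat_pow_distrib nat_pow_inv)
  have "\<exists>b d. R b d \<and> (\<forall>x c. R x c \<longrightarrow> (\<exists>k :: int. R (x \<otimes> inv (b [^] k)) 0))"
  proof (rule additive_relation_generator)
    show "R (x \<otimes> inv y) (c - d)" if "R x c" "R y d" for x y c d
      using that unfolding R_def by (subst dist) auto
  qed (auto simp: R_def)
  then obtain b d where b: "R b d" and gen: "\<And>x c. R x c \<Longrightarrow> \<exists>k :: int. R (x \<otimes> inv (b [^] k)) 0"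
    by blast
  have bQ: "b \<in> ?Q" and bc: "b \<in> carrier G" using b Q.subset by (auto simp: R_def)
  have R0: "x \<in> ?P" if "R x 0" for x
  proof -
    have "x \<in> carrier G" "x [^] M \<in> ?P" using that by (auto simp: R_def)
    then show ?thesis using pure_closure_pow M(1) by blast
  qed
  have all: "\<exists>k :: int. x \<otimes> inv (b [^] k) \<in> ?P" if "x \<in> ?Q" for x
  proof -
    from ex[OF MQ[OF that]] that obtain c where "R x c" unfolding R_def by blast
    then obtain k :: int where "R (x \<otimes> inv (b [^] k)) 0" using gen by blast
    then show ?thesis using R0 by blast
  qed
  have aQ: "a \<in> ?Q"
    using generate_le_pure_closure[OF aS] by (auto intro: generate.incl)
  \<comment> \<open>Otherwise every element of \<open>?Q\<close>, in particular \<open>a\<close>,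
    would lie in \<open>?P\<close>.\<close>
  have bP: "b \<notin> ?P"
  proof
    assume "b \<in> ?P"
    obtain k :: int where k: "a \<otimes> inv (b [^] k) \<in> ?P" using all[OF aQ] by blast
    moreover have "b [^] k \<in> ?P"
      using \<open>b \<in> ?P\<close> by (intro subgroup_int_pow_closed P.subgroup_axioms)
    ultimately have "(a \<otimes> inv (b [^] k)) \<otimes> b [^] k \<in> ?P" by (rule P.m_closed)
    then show False using a bc by (simp add: m_assoc)
  qed
  have "k = 0" if "b [^] k \<in> ?P" for k :: int
    using pure_closure_int_pow[OF bc _ that S] bP by blast
  with bQ all show ?thesis by blast
qed

text \<open>
  Pontryagin's criterion. The basis collects, for an enumeration of \<open>G\<close>, one generator for each proper
  step of the chain of pure closures of the initial segments; \<open>b n = \<one>\<close> marks the trivial steps.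
\<close>

lemma (in comm_group) free_abelian_of_pure_closure_fg:
  assumes "countable (carrier G)" "torsion_free_group G"
    and fg: "\<And>S. finite S \<Longrightarrow> S \<subseteq> carrier G \<Longrightarrow>
      \<exists>Y. finite Y \<and> Y \<subseteq> carrier G \<and> pure_closure G S = generate G Y"
  shows "free_abelian G"
proof -
  define a where "a = from_nat_into (carrier G)"
  have range_a: "range a = carrier G"
    unfolding a_def using assms(1) one_closed by (intro range_from_nat_into) auto
  then have ac: "a n \<in> carrier G" for n by blast
  define P where "P n = pure_closure G (a ` {..<n})" for n :: nat
  have sub_a: "a ` {..<n} \<subseteq> carrier G" for n :: nat using ac by blast
  have sub: "subgroup (P n) G" for n
    unfolding P_def by (rule subgroup_pure_closure[OF sub_a])
  have Suc_a: "a ` {..<Suc n} = insert (a n) (a ` {..<n})" for n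
    by (simp add: lessThan_Suc)
  have mono: "P m \<subseteq> P n" if "m \<le> n" for m n
    unfolding P_def by (rule pure_closure_mono) (use that in auto)
  \<comment> \<open>\<open>P 0\<close> is the torsion subgroup. This is where torsion-freeness
    enters; it starts the induction showing that \<open>B\<close> generates.\<close>
  have P0: "P 0 = {\<one>}"
    using assms(2) subgroup.one_closed[OF sub[of 0]]
    by (auto simp: P_def pure_closure_def generate_empty torsion_free_group_def)
  have "\<exists>b \<in> P (Suc n). (\<forall>x \<in> P (Suc n). \<exists>k :: int. x \<otimes> inv (b [^] k) \<in> P n) \<and>
      (b = \<one> \<or> (\<forall>k :: int. b [^] k \<in> P n \<longrightarrow> k = 0))" for n
  proof (cases "a n \<in> P n")
    case True
    have "insert (a n) (a ` {..<n}) \<subseteq> P n"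
      using True generate_le_pure_closure[OF sub_a[of n]] by (auto simp: P_def intro: generate.incl)
    then have "generate G (insert (a n) (a ` {..<n})) \<subseteq> P n"
      using sub by (rule generate_subgroup_incl)
    then have "x \<in> P n" if "x \<in> P (Suc n)" for x
      using that pure_closure_pow[of x _ "a ` {..<n}"]
      unfolding P_def Suc_a pure_closure_def[of G "insert (a n) (a ` {..<n})"] by blast
    then have "P (Suc n) \<subseteq> P n" by blast
    moreover have "x \<otimes> inv (\<one> [^] (0 :: int)) = x" if "x \<in> P n" for x
      using that subgroup.subset[OF sub[of n]] by auto
    ultimately show ?thesis
      using subgroup.one_closed[OF sub] by (metis subsetD)
  next
    case False
    obtain Y where Y: "finite Y" "Y \<subseteq> carrier G" "P (Suc n) = generate G Y"
      unfolding P_def using fg[of "a ` {..<Suc n}"] sub_a by blast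
    then show ?thesis
      using pure_closure_insert[OF sub_a ac, of n n Y] False unfolding P_def Suc_a by blast
  qed
  then obtain b where b: "\<And>n. b n \<in> P (Suc n)"
    and b_gen: "\<And>n x. x \<in> P (Suc n) \<Longrightarrow> \<exists>k :: int. x \<otimes> inv (b n [^] k) \<in> P n"
    and b_ind: "\<And>n k. b n \<noteq> \<one> \<Longrightarrow> b n [^] (k :: int) \<in> P n \<Longrightarrow> k = 0"
    by metis
  have bc: "b n \<in> carrier G" for n using b subgroup.subset[OF sub] by blast
  \<comment> \<open>The value \<open>\<one>\<close> marking trivial steps is discarded, as no
    independent set contains it.\<close>
  define B where "B = range b - {\<one>}"
  have Bc: "B \<subseteq> carrier G" using bc by (auto simp: B_def)
  interpret B: subgroup "generate G B" G using generate_is_subgroup[OF Bc] .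
  have bB: "b n \<in> generate G B" for n
    by (cases "b n = \<one>") (auto simp: B_def intro: generate.incl generate.one)
  have gen: "P n \<subseteq> generate G B" for n
  proof (induction n)
    case (Suc n)
    show ?case
    proof
      fix x assume x: "x \<in> P (Suc n)"
      then obtain k :: int where k: "x \<otimes> inv (b n [^] k) \<in> P n" using b_gen by blast
      moreover have "b n [^] k \<in> generate G B"
        by (rule subgroup_int_pow_closed[OF B.subgroup_axioms bB])
      ultimately have "(x \<otimes> inv (b n [^] k)) \<otimes> b n [^] k \<in> generate G B"
        using B.m_closed[OF subsetD[OF Suc]] by blast
      then show "x \<in> generate G B"
        using x bc subgroup.subset[OF sub] by (simp add: m_assoc subset_iff)
    qed
  qed (simp add: P0)
  have "carrier G \<subseteq> generate G B"
  proof
    fix x assume "x \<in> carrier G"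
    then obtain n where "x = a n" using range_a by blast
    then have "x \<in> P (Suc n)"
      using generate_le_pure_closure[OF sub_a[of "Suc n"]] by (auto simp: P_def intro: generate.incl)
    then show "x \<in> generate G B" using gen by blast
  qed
  then have "generate G B = carrier G" using B.subset by blast
  \<comment> \<open>The element with the highest index goes first: the relation puts
    \<open>b n [^] u (b n)\<close> into \<open>P n\<close>, since all other factors lie there, so
    this exponent is 0 and a shorter relation remains.\<close>
  moreover have indep: "\<forall>c\<in>T. u c = 0"
    if "finite T" "T \<subseteq> b ` {..<n} - {\<one>}" "(\<Otimes>c\<in>T. c [^] u c) = \<one>"
    for T n and u :: "'a \<Rightarrow> int"
    using that
  proof (induction n arbitrary: T)
    case (Suc n)
    show ?case
    proof (cases "b n \<in> T")
      case False
      then have "T \<subseteq> b ` {..<n} - {\<one>}" using Suc.prems(2) by (auto simp: lessThan_Suc)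
      then show ?thesis using Suc by blast
    next
      case True
      define T' where "T' = T - {b n}"
      have T': "finite T'" "T = insert (b n) T'" "b n \<notin> T'" "T' \<subseteq> b ` {..<n} - {\<one>}"
        using Suc.prems True by (auto simp: T'_def lessThan_Suc)
      have T'P: "T' \<subseteq> P n"
      proof
        fix c assume "c \<in> T'"
        then obtain m where "m < n" "c = b m" using T'(4) by blast
        then show "c \<in> P n" using b[of m] mono[of "Suc m" n] by auto
      qed
      then have T'c: "T' \<subseteq> carrier G" using subgroup.subset[OF sub] by blast
      have pr: "(\<Otimes>c\<in>T'. c [^] u c) \<in> P n"
        using T'P by (intro subgroup_finprod_closed sub subgroup_int_pow_closed) auto
      have "(\<Otimes>c\<in>T. c [^] u c) = b n [^] u (b n) \<otimes> (\<Otimes>c\<in>T'. c [^] u c)"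
        unfolding T'(2) using T'(1,3) T'c bc by (intro finprod_insert) auto
      then have eq: "b n [^] u (b n) \<otimes> (\<Otimes>c\<in>T'. c [^] u c) = \<one>"
        using Suc.prems(3) by simp
      then have "b n [^] u (b n) = inv (\<Otimes>c\<in>T'. c [^] u c)"
        using bc pr subgroup.subset[OF sub] by (metis inv_equality int_pow_closed subsetD)
      then have "b n [^] u (b n) \<in> P n"
        using pr subgroup.m_inv_closed[OF sub] by simp
      then have u0: "u (b n) = 0"
        using b_ind True Suc.prems(2) by blast
      then have "(\<Otimes>c\<in>T'. c [^] u c) = \<one>"
        using eq pr subgroup.subset[OF sub[of n]] by (simp add: subset_iff)
      then show ?thesis using Suc.IH[OF T'(1,4)] u0 T'(2) by simp
    qed
  qed simp
  have "int_independent G B"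
    unfolding int_independent_def
  proof (intro allI impI)
    fix T and u :: "'a \<Rightarrow> int"
    assume T: "finite T" "T \<subseteq> B" "(\<Otimes>c\<in>T. c [^] u c) = \<one>"
    then obtain N where N: "finite N" "T = b ` N"
      unfolding B_def by (meson Diff_subset finite_subset_image subset_trans)
    then obtain n where "N \<subseteq> {..<n}" using finite_nat_bounded by blast
    then have "T \<subseteq> b ` {..<n} - {\<one>}" using T(2) N(2) by (auto simp: B_def)
    from indep[OF T(1) this T(3)] show "\<forall>c\<in>T. u c = 0" .
  qed
  ultimately show ?thesis
    using Bc comm_group_axioms by (auto simp: free_abelian_def abelian_group_basis_def)
qed

section \<open>Meeting countably many requirements by finite approximations\<close>

text \<open>
  A Rasiowa--Sikorski argument: \<open>(D, g)\<close> stands for the finite partial function \<open>g\<close> restricted to \<open>D\<close>.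
\<close>

lemma countable_requirements_met:
  fixes B :: "'b set" and C :: "'c set" and P :: "'v \<Rightarrow> ('b \<Rightarrow> 'c) \<Rightarrow> bool"
  assumes "countable V" "C \<noteq> {}"
    and step: "\<And>v D g. v \<in> V \<Longrightarrow> finite D \<Longrightarrow> D \<subseteq> B \<Longrightarrow> g \<in> B \<rightarrow> C \<Longrightarrow>
      \<exists>D' g'. finite D' \<and> D \<subseteq> D' \<and> D' \<subseteq> B \<and> g' \<in> B \<rightarrow> C \<and> (\<forall>b\<in>D. g' b = g b) \<and>
        (\<forall>h \<in> B \<rightarrow> C. (\<forall>b\<in>D'. h b = g' b) \<longrightarrow> P v h)"
  shows "\<exists>h \<in> B \<rightarrow> C. \<forall>v\<in>V. P v h"
proof (cases "V = {}")
  case True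
  then show ?thesis using assms(2) by (auto intro!: bexI[of _ "\<lambda>_. SOME c. c \<in> C"] simp: some_in_eq)
next
  case False
  define w where "w = from_nat_into V"
  have w: "range w = V" unfolding w_def using False assms(1) by (rule range_from_nat_into)
  then have wV: "w n \<in> V" for n by blast
  define good where "good s \<longleftrightarrow> finite (fst s) \<and> fst s \<subseteq> B \<and> snd s \<in> B \<rightarrow> C"
    for s :: "'b set \<times> ('b \<Rightarrow> 'c)"
  \<comment> \<open>Stage \<open>Suc n\<close> settles requirement \<open>w n\<close>: whatever
    values are chosen later outside the finite domain of \<open>t\<close>, they cannot spoil
    it.\<close>
  define extends where "extends n s t \<longleftrightarrow> fst s \<subseteq> fst t \<and> (\<forall>b\<in>fst s. snd t b = snd s b) \<and>
      (\<forall>h \<in> B \<rightarrow> C. (\<forall>b\<in>fst t. h b = snd t b) \<longrightarrow> P (w n) h)"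
    for n and s t :: "'b set \<times> ('b \<Rightarrow> 'c)"
  obtain c where c: "c \<in> C" using assms(2) by blast
  have "\<exists>s. \<forall>n. good (s n) \<and> extends n (s n) (s (Suc n))"
  proof (rule dependent_nat_choice)
    show "\<exists>s. good s"
      using c by (intro exI[of _ "({}, \<lambda>_. c)"]) (auto simp: good_def)
  next
    fix s :: "'b set \<times> ('b \<Rightarrow> 'c)" and n assume "good s"
    then obtain D' g' where "finite D'" "fst s \<subseteq> D'" "D' \<subseteq> B" "g' \<in> B \<rightarrow> C"
      "\<forall>b\<in>fst s. g' b = snd s b" "\<forall>h \<in> B \<rightarrow> C. (\<forall>b\<in>D'. h b = g' b) \<longrightarrow> P (w n) h"
      using step[OF wV[of n], of "fst s" "snd s"] unfolding good_def by blast
    then show "\<exists>t. good t \<and> extends n s t"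
      by (intro exI[of _ "(D', g')"]) (simp add: good_def extends_def)
  qed
  then obtain s where good: "\<And>n. good (s n)" and ext: "\<And>n. extends n (s n) (s (Suc n))" by blast
  define D g where "D n = fst (s n)" and "g n = snd (s n)" for n
  have D: "D n \<subseteq> D (Suc n)" and g_Suc: "b \<in> D n \<Longrightarrow> g (Suc n) b = g n b" for n b
    using ext[of n] by (auto simp: extends_def D_def g_def)
  have agree: "b \<in> D n \<and> g n b = g m b" if "m \<le> n" "b \<in> D m" for m n b
    using that
  proof (induction n rule: dec_induct)
    case (step n)
    then show ?case using D[of n] g_Suc[of b n] by auto
  qed simp
  \<comment> \<open>The union of the chain. By \<open>agree\<close>, any stage that contains
    \<open>b\<close> gives the same value, the least one being a mere choice; \<open>c\<close> fills
    the places that no stage reaches.\<close>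
  define h where "h b = (if \<exists>n. b \<in> D n then g (LEAST n. b \<in> D n) b else c)" for b
  have h: "h b = g n b" if "b \<in> D n" for b n
    using agree[of "LEAST n. b \<in> D n" n b] Least_le[of "\<lambda>n. b \<in> D n", OF that]
      LeastI[of "\<lambda>n. b \<in> D n", OF that] that by (auto simp: h_def)
  have gC: "g n \<in> B \<rightarrow> C" for n using good[of n] by (simp add: good_def g_def)
  have hC: "h \<in> B \<rightarrow> C" using c gC[THEN funcset_mem] by (auto simp: h_def)
  moreover have "P (w n) h" for n
    using ext[of n] hC h[of _ "Suc n"] by (auto simp: extends_def D_def g_def)
  ultimately show ?thesis using w by blast
qed

section \<open>Lifting along the exact sequence and choosing the values\<close>

lemma (in comm_group) finprod_nat_pow:
  assumes "f \<in> T \<rightarrow> carrier G"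
  shows "(\<Otimes>b\<in>T. f b) [^] (n :: nat) = (\<Otimes>b\<in>T. f b [^] n)"
  using assms
proof (induction T rule: infinite_finite_induct)
  case (insert b T)
  then have "f \<in> T \<rightarrow> carrier G" "f b \<in> carrier G" "(\<lambda>b. f b [^] n) \<in> T \<rightarrow> carrier G" by auto
  with insert show ?case by (simp add: nat_pow_distrib)
qed simp_all

text \<open>The image of \<open>generate G E\<close> is generated by the image of \<open>E\<close>,
  so a suitable power of \<open>x\<close> has a preimage \<open>e\<close> there; \<open>e\<close>
  and the same power of a lift of \<open>x\<close> differ by an element of the kernel.\<close>

lemma (in group_hom) lift_of_pure_closure:
  assumes "E \<subseteq> carrier G" "x \<in> pure_closure H (h ` E)" "h ` carrier G = carrier H"
  obtains f e and m :: nat where "f \<in> carrier G" "h f = x" "m > 0" "e \<in> generate G E"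
    "f [^] m \<otimes> inv e \<in> kernel G H h"
proof -
  obtain m :: nat where m: "x \<in> carrier H" "m > 0" "x [^]\<^bsub>H\<^esub> m \<in> generate H (h ` E)"
    using assms(2) unfolding pure_closure_def by blast
  then obtain e where e: "e \<in> generate G E" "h e = x [^]\<^bsub>H\<^esub> m"
    using generate_img[OF assms(1)] by (metis imageE)
  obtain f where f: "f \<in> carrier G" "h f = x" using m(1) assms(3) by (metis imageE)
  have ec: "e \<in> carrier G" using e(1) by (rule G.generate_in_carrier[OF assms(1)])
  have "h (f [^] m \<otimes> inv e) = \<one>\<^bsub>H\<^esub>"
    using f ec e(2) m(1) by (simp add: hom_nat_pow)
  then have "f [^] m \<otimes> inv e \<in> kernel G H h"
    using f(1) ec by (simp add: kernel_def)
  with f m(2) e(1) show thesis by (rule that)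
qed

text \<open>If \<open>m\<close> divided every coefficient outside \<open>D\<close>, that part of the
  product would be the \<open>m\<close>-th power of some \<open>k\<close> in the kernel. Then
  \<open>f\<close> times the inverse of \<open>k\<close> has its \<open>m\<close>-th power in
  \<open>generate F (E \<union> D)\<close> and the same image as \<open>f\<close>, which contradicts
  \<open>out\<close>.\<close>

lemma exists_indivisible_coefficient:
  fixes F :: "('f, 'n) monoid_scheme" and A :: "('a, 'm) monoid_scheme"
    and m :: nat and u :: "'f \<Rightarrow> int"
  assumes "comm_group F" "group_hom F A p"
    and "E \<subseteq> carrier F" "B \<subseteq> kernel F A p" "finite T" "T \<subseteq> B" "D \<subseteq> B"
    and "f \<in> carrier F" "e \<in> generate F E" "m > 0"
    and fm: "f [^]\<^bsub>F\<^esub> m = (\<Otimes>\<^bsub>F\<^esub>b\<in>T. b [^]\<^bsub>F\<^esub> u b) \<otimes>\<^bsub>F\<^esub> e"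
    and out: "p f \<notin> p ` pure_closure F (E \<union> D)"
  shows "\<exists>b \<in> T - D. \<not> int m dvd u b"
proof (rule ccontr)
  assume "\<not> ?thesis"
  then have dvd: "int m dvd u b" if "b \<in> T - D" for b using that by blast
  interpret F: comm_group F by fact
  interpret p: group_hom F A p by fact
  interpret K: subgroup "kernel F A p" F by (rule p.subgroup_kernel)
  have Bc: "B \<subseteq> carrier F" using assms(4) K.subset by blast
  then have Tc: "T \<subseteq> carrier F" and EDc: "E \<union> D \<subseteq> carrier F" using assms by auto
  interpret ED: subgroup "generate F (E \<union> D)" F using F.generate_is_subgroup[OF EDc] .
  define r where "r = (\<Otimes>\<^bsub>F\<^esub>b\<in>T \<inter> D. b [^]\<^bsub>F\<^esub> u b)"
  define k where "k = (\<Otimes>\<^bsub>F\<^esub>b\<in>T - D. b [^]\<^bsub>F\<^esub> (u b div int m))"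
  have r: "r \<in> generate F (E \<union> D)"
    unfolding r_def
    by (intro F.subgroup_finprod_closed ED.subgroup_axioms
        F.subgroup_int_pow_closed generate.incl) auto
  have k: "k \<in> kernel F A p"
    unfolding k_def using assms(4,6)
    by (intro F.subgroup_finprod_closed K.subgroup_axioms
        F.subgroup_int_pow_closed) auto
  have e: "e \<in> generate F (E \<union> D)"
    using F.mono_generate[of E "E \<union> D"] assms(9) by auto
  have rc: "r \<in> carrier F" and kc: "k \<in> carrier F" and ec: "e \<in> carrier F"
    using r k e ED.subset K.subset by auto
  have "k [^]\<^bsub>F\<^esub> m = (\<Otimes>\<^bsub>F\<^esub>b\<in>T - D. (b [^]\<^bsub>F\<^esub> (u b div int m)) [^]\<^bsub>F\<^esub> m)"
    unfolding k_def using Tc by (intro F.finprod_nat_pow) auto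
  also have "\<dots> = (\<Otimes>\<^bsub>F\<^esub>b\<in>T - D. b [^]\<^bsub>F\<^esub> u b)"
  proof (intro F.finprod_cong' refl)
    fix b assume b: "b \<in> T - D"
    have "(b [^]\<^bsub>F\<^esub> (u b div int m)) [^]\<^bsub>F\<^esub> int m = b [^]\<^bsub>F\<^esub> u b"
      using b Tc dvd[OF b] by (subst F.int_pow_pow) auto
    then show "(b [^]\<^bsub>F\<^esub> (u b div int m)) [^]\<^bsub>F\<^esub> m = b [^]\<^bsub>F\<^esub> u b"
      by (simp add: int_pow_int)
  qed (use Tc in auto)
  finally have km: "k [^]\<^bsub>F\<^esub> m = (\<Otimes>\<^bsub>F\<^esub>b\<in>T - D. b [^]\<^bsub>F\<^esub> u b)" .
  have "(\<Otimes>\<^bsub>F\<^esub>b\<in>(T \<inter> D) \<union> (T - D). b [^]\<^bsub>F\<^esub> u b) = r \<otimes>\<^bsub>F\<^esub> k [^]\<^bsub>F\<^esub> m"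
    unfolding km r_def using Tc assms(5) by (intro F.finprod_Un_disjoint) auto
  then have "f [^]\<^bsub>F\<^esub> m = r \<otimes>\<^bsub>F\<^esub> k [^]\<^bsub>F\<^esub> m \<otimes>\<^bsub>F\<^esub> e"
    using fm by (simp add: Int_Diff_Un)
  then have "(f \<otimes>\<^bsub>F\<^esub> inv\<^bsub>F\<^esub> k) [^]\<^bsub>F\<^esub> m
      = (r \<otimes>\<^bsub>F\<^esub> k [^]\<^bsub>F\<^esub> m \<otimes>\<^bsub>F\<^esub> e) \<otimes>\<^bsub>F\<^esub> inv\<^bsub>F\<^esub> (k [^]\<^bsub>F\<^esub> m)"
    using assms(8) kc by (simp add: F.nat_pow_distrib F.nat_pow_inv)
  also have "\<dots> = r \<otimes>\<^bsub>F\<^esub> e \<otimes>\<^bsub>F\<^esub> (k [^]\<^bsub>F\<^esub> m \<otimes>\<^bsub>F\<^esub> inv\<^bsub>F\<^esub> (k [^]\<^bsub>F\<^esub> m))"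
    using rc kc ec F.nat_pow_closed[OF kc, of m] F.inv_closed[OF F.nat_pow_closed[OF kc, of m]]
    by (simp only: F.m_ac F.m_closed)
  also have "\<dots> = r \<otimes>\<^bsub>F\<^esub> e"
    using rc kc ec by (simp add: F.r_inv)
  finally have "(f \<otimes>\<^bsub>F\<^esub> inv\<^bsub>F\<^esub> k) [^]\<^bsub>F\<^esub> m \<in> generate F (E \<union> D)"
    using r e by simp
  moreover have "f \<otimes>\<^bsub>F\<^esub> inv\<^bsub>F\<^esub> k \<in> carrier F"
    using assms(8) kc by simp
  ultimately have "f \<otimes>\<^bsub>F\<^esub> inv\<^bsub>F\<^esub> k \<in> pure_closure F (E \<union> D)"
    unfolding pure_closure_def using assms(10) by (intro CollectI conjI exI[of _ m])
  then have img: "p (f \<otimes>\<^bsub>F\<^esub> inv\<^bsub>F\<^esub> k) \<in> p ` pure_closure F (E \<union> D)"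
    by (rule imageI)
  have pk: "p k = \<one>\<^bsub>A\<^esub>" using k by (simp only: kernel_def mem_Collect_eq)
  have "p (f \<otimes>\<^bsub>F\<^esub> inv\<^bsub>F\<^esub> k) = p f \<otimes>\<^bsub>A\<^esub> inv\<^bsub>A\<^esub> p k"
    using assms(8) kc by (simp only: p.hom_mult p.hom_inv F.inv_closed)
  also have "\<dots> = p f"
    using assms(8) by (simp add: pk)
  finally show False using out img by simp
qed

theorem theorem4p2:
  fixes A :: "('a, 'm) monoid_scheme"
    and F :: "('f, 'n) monoid_scheme"
    and K B\<^sub>K :: "'f set"
    and \<pi> :: "'f \<Rightarrow> 'a"
  assumes "comm_group A"
    and "countable (carrier A)"
    and "torsion_free_group A"
    and "\<not> free_abelian A"
    and "free_abelian F"
    and "free_abelian (F\<lparr>carrier := K\<rparr>)"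
    and "exact_inclusion K F \<pi> A"
    and "abelian_group_basis (F\<lparr>carrier := K\<rparr>) B\<^sub>K"
  shows "\<exists>\<phi> \<in> hom (F\<lparr>carrier := K\<rparr>) integer_group.
           \<not> (\<exists>\<psi> \<in> hom F integer_group. \<forall>x\<in>K. \<psi> x = \<phi> x) \<and>
           \<phi> ` B\<^sub>K \<subseteq> {0, 1}"
proof -
  interpret A: comm_group A by fact
  interpret F: comm_group F using assms(5) by (simp add: free_abelian_def)
  interpret FK: comm_group "F\<lparr>carrier := K\<rparr>" using assms(6) by (simp add: free_abelian_def)
  have K: "subgroup K F" and ker: "kernel F A \<pi> = K" and surj: "\<pi> ` carrier F = carrier A"
    and hom: "\<pi> \<in> hom F A"
    using assms(7) by (auto simp: exact_inclusion_def)
  interpret p: group_hom F A \<pi> using hom by (simp add: group_hom_def group_hom_axioms_def)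
  interpret K: subgroup K F by fact
  have BK: "B\<^sub>K \<subseteq> K" and genK: "generate F B\<^sub>K = K"
    using assms(8) F.generate_consistent[OF _ K, of "B\<^sub>K"] by (auto simp: abelian_group_basis_def)
  have BKc: "B\<^sub>K \<subseteq> carrier F" using BK K.subset by blast
  obtain S where S: "finite S" "S \<subseteq> carrier A"
    and not_fg: "\<not> (\<exists>Y. finite Y \<and> Y \<subseteq> carrier A \<and> pure_closure A S = generate A Y)"
    using A.free_abelian_of_pure_closure_fg[OF assms(2,3)] assms(4) by blast
  obtain E where E: "finite E" "E \<subseteq> carrier F" "S = \<pi> ` E"
    using S surj by (metis finite_subset_image)
  \<comment> \<open>Listing \<open>E\<close> turns the restriction of an extension to
    \<open>E\<close> into a list of integers. There are only countably many such lists, and each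
    gives one requirement \<open>?P vs\<close>.\<close>
  obtain es where es: "set es = E" using E(1) finite_list by blast
  let ?P = "\<lambda>vs g. \<not> (\<exists>\<psi> \<in> hom F integer_group. (\<forall>b\<in>B\<^sub>K. \<psi> b = g b) \<and> map \<psi> es = vs)"
  have "\<exists>g \<in> B\<^sub>K \<rightarrow> {0, 1 :: int}. \<forall>vs \<in> range (\<lambda>v. map v es). ?P vs g"
  proof (rule countable_requirements_met)
    fix vs :: "int list" and D and g :: "'f \<Rightarrow> int"
    assume "vs \<in> range (\<lambda>v. map v es)" and D: "finite D" "D \<subseteq> B\<^sub>K" and g: "g \<in> B\<^sub>K \<rightarrow> {0, 1}"
    then obtain v where v: "vs = map v es" by blast
    have EDc: "E \<union> D \<subseteq> carrier F" using E D BKc by blast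
    obtain Y where Y: "finite Y" "Y \<subseteq> carrier F" "pure_closure F (E \<union> D) = generate F Y"
      using F.pure_closure_fg_of_free[OF assms(5) _ EDc] E D by blast
    have \<pi>Y: "finite (\<pi> ` Y)" "\<pi> ` Y \<subseteq> carrier A" using Y by auto
    \<comment> \<open>Otherwise \<open>pure_closure A S\<close>, as a subgroup of a finitely
      generated group, would be finitely generated.\<close>
    have "\<not> pure_closure A S \<subseteq> generate A (\<pi> ` Y)"
    proof
      assume "pure_closure A S \<subseteq> generate A (\<pi> ` Y)"
      from A.subgroup_of_fg[OF \<pi>Y A.subgroup_pure_closure[OF S(2)] this]
      show False using not_fg pure_closure_carrier[of A S] by blast
    qed
    then obtain x where x: "x \<in> pure_closure A S" "x \<notin> \<pi> ` pure_closure F (E \<union> D)"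
      unfolding Y(3) p.generate_img[OF Y(2)] by blast
    obtain f e and m :: nat where f: "f \<in> carrier F" "\<pi> f = x" and m: "m > 0"
      and e: "e \<in> generate F E" and fe: "f [^]\<^bsub>F\<^esub> m \<otimes>\<^bsub>F\<^esub> inv\<^bsub>F\<^esub> e \<in> K"
      using p.lift_of_pure_closure[OF E(2) _ surj] x(1) unfolding E(3) ker by metis
    obtain T where T: "finite T" "T \<subseteq> B\<^sub>K" "f [^]\<^bsub>F\<^esub> m \<otimes>\<^bsub>F\<^esub> inv\<^bsub>F\<^esub> e \<in> generate F T"
      using F.generate_finite_support fe genK by metis
    have Tc: "T \<subseteq> carrier F" using T(2) BKc by blast
    obtain u :: "'f \<Rightarrow> int" where u: "f [^]\<^bsub>F\<^esub> m \<otimes>\<^bsub>F\<^esub> inv\<^bsub>F\<^esub> e = (\<Otimes>\<^bsub>F\<^esub>b\<in>T. b [^]\<^bsub>F\<^esub> u b)"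
      using F.generate_finite_rep[OF T(1) Tc T(3)] by blast
    obtain c :: "'f \<Rightarrow> int" where c: "e = (\<Otimes>\<^bsub>F\<^esub>t\<in>E. t [^]\<^bsub>F\<^esub> c t)"
      using F.generate_finite_rep[OF E(1,2) e] by blast
    have ec: "e \<in> carrier F" using F.generate_in_carrier[OF E(2) e] .
    have "(f [^]\<^bsub>F\<^esub> m \<otimes>\<^bsub>F\<^esub> inv\<^bsub>F\<^esub> e) \<otimes>\<^bsub>F\<^esub> e = f [^]\<^bsub>F\<^esub> m"
      using f ec by (simp add: F.m_assoc)
    then have fm: "f [^]\<^bsub>F\<^esub> m = (\<Otimes>\<^bsub>F\<^esub>b\<in>T. b [^]\<^bsub>F\<^esub> u b) \<otimes>\<^bsub>F\<^esub> e"
      unfolding u by simp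
    obtain b0 where b0: "b0 \<in> T" "b0 \<notin> D" "\<not> int m dvd u b0"
      using exists_indivisible_coefficient[OF F.comm_group_axioms p.group_hom_axioms E(2) _ T(1,2)
          D(2) f(1) e m fm] x(2) f(2) BK ker by blast
    \<comment> \<open>The value at \<open>b0\<close> is left open. The 0 on the rest of
      \<open>T - D\<close> is arbitrary: those values only have to be the same for both choices of
      \<open>\<epsilon>\<close>.\<close>
    define g' where "g' \<epsilon> b = (if b \<in> D then g b else if b = b0 then \<epsilon> else 0)" for \<epsilon> b
    \<comment> \<open>This is the value at \<open>f [^] m\<close> of any extension that agrees with
      \<open>g' \<epsilon>\<close> on \<open>T\<close> and with \<open>v\<close> on
      \<open>E\<close>. For \<open>\<epsilon>\<close> equal to 0 and 1 these values differ by
      \<open>u b0\<close>, so \<open>m\<close> cannot divide both.\<close>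
    define w where "w \<epsilon> = (\<Sum>b\<in>T. u b * g' \<epsilon> b) + (\<Sum>t\<in>E. c t * v t)" for \<epsilon>
    have "w 1 - w 0 = (\<Sum>b\<in>T. u b * g' 1 b - u b * g' 0 b)"
      by (simp add: w_def sum_subtractf)
    also have "\<dots> = (\<Sum>b\<in>T. if b = b0 then u b else 0)"
      using b0(2) by (intro sum.cong) (auto simp: g'_def)
    also have "\<dots> = u b0" using T(1) b0(1) by simp
    finally have "\<not> (int m dvd w 1 \<and> int m dvd w 0)"
      using b0(3) by (metis dvd_diff)
    then obtain \<epsilon> where \<epsilon>: "\<epsilon> \<in> {0, 1}" "\<not> int m dvd w \<epsilon>" by blast
    show "\<exists>D' g'. finite D' \<and> D \<subseteq> D' \<and> D' \<subseteq> B\<^sub>K \<and> g' \<in> B\<^sub>K \<rightarrow> {0, 1} \<and>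
        (\<forall>b\<in>D. g' b = g b) \<and> (\<forall>h \<in> B\<^sub>K \<rightarrow> {0, 1}. (\<forall>b\<in>D'. h b = g' b) \<longrightarrow> ?P vs h)"
    proof (intro exI conjI ballI impI)
      \<comment> \<open>\<open>T\<close> is added as a whole, for \<open>w\<close> depends on the
        values at all of \<open>T\<close>.\<close>
      show "finite (D \<union> T)" "D \<subseteq> D \<union> T" "D \<union> T \<subseteq> B\<^sub>K" using D T by auto
      show "g' \<epsilon> \<in> B\<^sub>K \<rightarrow> {0, 1}" using g[THEN funcset_mem] \<epsilon>(1) by (auto simp: g'_def)
      show "g' \<epsilon> b = g b" if "b \<in> D" for b using that by (simp add: g'_def)
      show "?P vs h" if h: "\<forall>b\<in>D \<union> T. h b = g' \<epsilon> b" for h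
      proof
        assume "\<exists>\<psi> \<in> hom F integer_group. (\<forall>b\<in>B\<^sub>K. \<psi> b = h b) \<and> map \<psi> es = vs"
        then obtain \<psi> where \<psi>: "\<psi> \<in> hom F integer_group" "\<And>b. b \<in> B\<^sub>K \<Longrightarrow> \<psi> b = h b"
          and map: "map \<psi> es = vs" by blast
        have \<psi>v: "\<psi> t = v t" if "t \<in> E" for t using map that v es by simp
        interpret \<psi>: group_hom F integer_group \<psi>
          using \<psi>(1) by (simp add: group_hom_def group_hom_axioms_def)
        have "\<psi> (f [^]\<^bsub>F\<^esub> m) = \<psi> (\<Otimes>\<^bsub>F\<^esub>b\<in>T. b [^]\<^bsub>F\<^esub> u b) + \<psi> e"
          unfolding fm using ec Tc by (subst \<psi>.hom_mult) (auto intro!: F.finprod_closed)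
        also have "\<dots> = (\<Sum>b\<in>T. u b * \<psi> b) + (\<Sum>t\<in>E. c t * \<psi> t)"
          unfolding c using F.hom_integer_group_finprod[OF \<psi>(1)] Tc E(2) by simp
        also have "(\<Sum>b\<in>T. u b * \<psi> b) = (\<Sum>b\<in>T. u b * g' \<epsilon> b)"
          using \<psi>(2) T(2) h by (intro sum.cong) auto
        also have "(\<Sum>t\<in>E. c t * \<psi> t) = (\<Sum>t\<in>E. c t * v t)"
          using \<psi>v by (intro sum.cong) auto
        \<comment> \<open>Both computations of \<open>\<psi> (f [^] m)\<close> together make
          \<open>m\<close> a divisor of \<open>w \<epsilon>\<close>.\<close>
        finally have "int m * \<psi> f = w \<epsilon>"
          using \<psi>.hom_nat_pow[OF f(1), of m] by (simp add: w_def)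
        then show False using \<epsilon>(2) by (metis dvd_triv_left)
      qed
    qed
  qed auto
  then obtain g where g: "g \<in> B\<^sub>K \<rightarrow> {0, 1 :: int}"
    and P: "\<forall>vs \<in> range (\<lambda>v. map v es). ?P vs g" by (rule bexE)
  obtain \<phi> where \<phi>: "\<phi> \<in> hom (F\<lparr>carrier := K\<rparr>) integer_group" "\<And>b. b \<in> B\<^sub>K \<Longrightarrow> \<phi> b = g b"
    using FK.hom_extends_basis[OF assms(8), of g] by blast
  have "\<not> (\<exists>\<psi> \<in> hom F integer_group. \<forall>x\<in>K. \<psi> x = \<phi> x)"
  proof
    assume "\<exists>\<psi> \<in> hom F integer_group. \<forall>x\<in>K. \<psi> x = \<phi> x"
    then obtain \<psi> where \<psi>: "\<psi> \<in> hom F integer_group" "\<forall>x\<in>K. \<psi> x = \<phi> x" by (rule bexE)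
    then have "\<forall>b\<in>B\<^sub>K. \<psi> b = g b" using \<phi>(2) BK by auto
    \<comment> \<open>The values of \<open>\<psi>\<close> on \<open>es\<close> form one of the
      candidate lists, so the requirement for this list already excludes
      \<open>\<psi>\<close>.\<close>
    moreover have "?P (map \<psi> es) g" using P by (rule bspec) (rule rangeI)
    ultimately show False using \<psi>(1) by blast
  qed
  moreover have "\<phi> ` B\<^sub>K \<subseteq> {0, 1}"
    using g[THEN funcset_mem] \<phi>(2) by auto
  ultimately show ?thesis using \<phi>(1) by blast
qed

end
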